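(* Let $n\ge 1$, $k\ge 1$, and let $P(x,y)=\sum_{i=0}^n\sum_{j=0}^{n-i}x^iy^jP_{ij}$ be a bivariate matrix polynomial of degree $n$ with coefficients $P_{ij}\in\mathbb{C}^{k\times k}$. Let $G'$ be the directed rooted tree with root $1$ whose nodes are exactly the monomials $x^jy^l$ with $j,l\ge 0$, $j+l<n$ and either $l=0$ or $j$ even. Then $G'$ has $\psi(n)$ nodes, where \[ \psi(n)=\begin{cases}\frac14 n(n+4), & n \text{ even},\\[2pt] \frac14 (n-1)(n+5)+1, & n\text{ odd},\end{cases} \] and $P(x,y)$ admits a linearization $A+xB+yC$ using the tree $G'$, with matrices $A,B,C$ of block size $\psi(n)$, that is, $A,B,C\in\mathbb{C}^{\psi(n)k\times\psi(n)k}$.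
   Context: Linearization: a linear pencil $A+xB+yC$ with $m'\times m'$ matrices $A,B,C$ is a linearization of a $k\times k$ matrix polynomial $P(x,y)$ if there exist polynomial matrices $L(x,y)$ and $Q(x,y)$ of size $m'\times m'$ with $\det L(x,y)\equiv\det Q(x,y)\equiv 1$ and \[ L(x,y)\,(A+xB+yC)\,Q(x,y)=\begin{bmatrix}P(x,y)&0\\0&I_{m'-k}\end{bmatrix}. \] The tree $G'$: in the directed graph on all monomials $x^jy^l$ with $j+l<n$, there is an edge from node $s$ to node $t$ if $t=xs$ (an $x$-edge) or $t=ys$ (a $y$-edge). On the node set specified in the claim, every node other than $1$ has exactly one predecessor in the set along such edges, and these edges form the tree $G'$ with root $1$. Linearization using the tree $G'$: let $s_1=1,s_2,\dots,s_m$ be the nodes of $G'$ ordered so that $x^ay^b$ precedes $x^cy^d$ if $a+b<c+d$, or $a+b=c+d$ and $a>c$. A linearization $M(x,y)=A+xB+yC$ uses $G'$ if it is an $m\times m$ block matrix with $k\times k$ blocks such that: (i) for each $q\in\{2,\dots,m\}$, if $s_p$ is the predecessor of $s_q$ in $G'$, then block row $q$ has $I_k$ in block position $(q,q)$, has $-xI_k$ (if the edge from $s_p$ to $s_q$ is an $x$-edge) or $-yI_k$ (if it is a $y$-edge) in block position $(q,p)$, and zero blocks elsewhere; (ii) the blocks $M_{11},\dots,M_{1m}$ of the first block row are linear pencils of the form $A_{1i}+xB_{1i}+yC_{1i}$ satisfying $\sum_{i=1}^m s_i\,M_{1i}(x,y)=P(x,y)$. *)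

theory Defs
  imports
    Complex_Main
    "HOL-Computational_Algebra.Polynomial"
    "Jordan_Normal_Form.Matrix"
    "Jordan_Normal_Form.Determinant"
    "Graph_Theory.Digraph"
    "Graph_Theory.Arc_Walk"
    "Graph_Theory.Pair_Digraph"
    "Graph_Theory.Digraph_Component"
begin

section \<open>Bivariate polynomials and polynomial matrices\<close>

text \<open>
  The ring of bivariate complex polynomials is \<open>complex poly poly\<close>: the inner variable is
  \<open>x\<close>, the outer variable is \<open>y\<close>. Matrices are those of the AFP entry on Jordan normal forms,
  whose dimensions are values; rows, columns and blocks are counted from 0.
\<close>

type_synonym bipoly = "complex poly poly"

definition bvarx :: bipoly where
  "bvarx = [:[:0, 1:]:]"

definition bvary :: bipoly where
  "bvary = [:0, 1:]"

definition bconst :: "complex \<Rightarrow> bipoly" where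
  "bconst c = [:[:c:]:]"

definition matrix_poly :: "nat \<Rightarrow> nat \<Rightarrow> (nat \<Rightarrow> nat \<Rightarrow> complex mat) \<Rightarrow> bipoly mat" where
  "matrix_poly n k P =
     mat k k (\<lambda>(a, b). \<Sum>i=0..n. \<Sum>j=0..n-i. bvarx ^ i * bvary ^ j * bconst (P i j $$ (a, b)))"

definition linear_pencil :: "complex mat \<Rightarrow> complex mat \<Rightarrow> complex mat \<Rightarrow> bipoly mat" where
  "linear_pencil A B C =
     map_mat bconst A + bvarx \<cdot>\<^sub>m map_mat bconst B + bvary \<cdot>\<^sub>m map_mat bconst C"

definition is_linearization ::
    "nat \<Rightarrow> nat \<Rightarrow> complex mat \<Rightarrow> complex mat \<Rightarrow> complex mat \<Rightarrow> bipoly mat \<Rightarrow> bool" where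
  "is_linearization m k A B C P \<longleftrightarrow>
     k \<le> m \<and>
     A \<in> carrier_mat m m \<and> B \<in> carrier_mat m m \<and> C \<in> carrier_mat m m \<and>
     P \<in> carrier_mat k k \<and>
     (\<exists>L \<in> carrier_mat m m. \<exists>Q \<in> carrier_mat m m.
        det L = 1 \<and> det Q = 1 \<and>
        L * linear_pencil A B C * Q =
          four_block_mat P (0\<^sub>m k (m - k)) (0\<^sub>m (m - k) k) (1\<^sub>m (m - k)))"

definition mat_block :: "nat \<Rightarrow> 'a mat \<Rightarrow> nat \<Rightarrow> nat \<Rightarrow> 'a mat" where
  "mat_block k M q p = mat k k (\<lambda>(a, b). M $$ (q * k + a, p * k + b))"


section \<open>The graph of monomials\<close>

text \<open>The pair \<open>(j, l)\<close> stands for the monomial \<open>x\<^sup>j y\<^sup>l\<close>; the monomial 1 is \<open>(0, 0)\<close>.\<close>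

type_synonym monomial = "nat \<times> nat"

definition monomial_poly :: "monomial \<Rightarrow> bipoly" where
  "monomial_poly s = bvarx ^ fst s * bvary ^ snd s"

definition x_edge :: "monomial \<Rightarrow> monomial \<Rightarrow> bool" where
  "x_edge s t \<longleftrightarrow> t = (Suc (fst s), snd s)"

definition y_edge :: "monomial \<Rightarrow> monomial \<Rightarrow> bool" where
  "y_edge s t \<longleftrightarrow> t = (fst s, Suc (snd s))"

definition monomial_graph :: "nat \<Rightarrow> monomial pair_pre_digraph" where
  "monomial_graph n =
     \<lparr> pverts = {(j, l). j + l < n},
       parcs = {(s, t). fst s + snd s < n \<and> fst t + snd t < n \<and> (x_edge s t \<or> y_edge s t)} \<rparr>"

definition monomial_tree :: "nat \<Rightarrow> (monomial, monomial \<times> monomial) pre_digraph" where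
  "monomial_tree n =
     with_proj (monomial_graph n) \<restriction> {(j, l). j + l < n \<and> (l = 0 \<or> even j)}"

text \<open>
  The predicate \<open>tree\<close> of the graph library asks for weak connectedness and the absence of
  directed cycles only, so it admits nodes with several predecessors. Here every node is reached
  from the root by exactly one directed walk.
\<close>

definition rooted_directed_tree :: "('a, 'b) pre_digraph \<Rightarrow> 'a \<Rightarrow> bool" where
  "rooted_directed_tree G r \<longleftrightarrow>
     wf_digraph G \<and> r \<in> verts G \<and> (\<forall>v \<in> verts G. \<exists>!p. pre_digraph.awalk G r p v)"

definition precedes :: "monomial \<Rightarrow> monomial \<Rightarrow> bool" where
  "precedes s t \<longleftrightarrow>
     fst s + snd s < fst t + snd t \<or> (fst s + snd s = fst t + snd t \<and> fst s > fst t)"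

text \<open>
  The list \<open>s\<close> below is determined by \<open>G\<close>, because \<open>precedes\<close> is a strict total order. The blocks
  of the first block row of a linear pencil are automatically linear pencils.
\<close>

definition uses_tree ::
    "(monomial, monomial \<times> monomial) pre_digraph \<Rightarrow> nat \<Rightarrow>
     complex mat \<Rightarrow> complex mat \<Rightarrow> complex mat \<Rightarrow> bipoly mat \<Rightarrow> bool" where
  "uses_tree G k A B C P \<longleftrightarrow>
     (\<exists>s. set s = verts G \<and> sorted_wrt precedes s \<and>
        (let m = length s; M = linear_pencil A B C in
           A \<in> carrier_mat (m * k) (m * k) \<and> B \<in> carrier_mat (m * k) (m * k) \<and>
           C \<in> carrier_mat (m * k) (m * k) \<and>
           is_linearization (m * k) k A B C P \<and>
           (\<forall>q \<in> {1..<m}. \<exists>p<m. s ! p \<rightarrow>\<^bsub>G\<^esub> s ! q \<and>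
              (\<forall>r<m. mat_block k M q r =
                 (if r = q then 1\<^sub>m k
                  else if r = p then (if x_edge (s ! p) (s ! q) then - bvarx else - bvary) \<cdot>\<^sub>m 1\<^sub>m k
                  else 0\<^sub>m k k))) \<and>
           mat k k (\<lambda>ab. \<Sum>i<m. monomial_poly (s ! i) * mat_block k M 0 i $$ ab) = P))"

definition psi :: "nat \<Rightarrow> nat" where
  "psi n = (if even n then n * (n + 4) div 4 else (n - 1) * (n + 5) div 4 + 1)"

text \<open>The divisions and the subtraction in \<open>psi\<close> are exact.\<close>

lemma real_psi:
  "real (psi n) =
     (if even n then 1 / 4 * real n * (real n + 4)
      else 1 / 4 * (real n - 1) * (real n + 5) + 1)"
proof (cases "even n")
  case True
  then obtain a where "n = 2 * a" ..
  moreover have "2 * a * (2 * a + 4) = 4 * (a * (a + 2))" by (simp add: algebra_simps)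
  ultimately show ?thesis by (simp add: psi_def algebra_simps)
next
  case False
  then obtain a where "n = 2 * a + 1" by (rule oddE)
  moreover have "2 * a * (2 * a + 1 + 5) = 4 * (a * (a + 3))" by (simp add: algebra_simps)
  ultimately show ?thesis by (simp add: psi_def algebra_simps)
qed

end

theory Submission
  imports Defs
begin

section \<open>Unitriangular matrices\<close>

lemma det_lower_unitriangular:
  fixes A :: "'a::comm_ring_1 mat"
  assumes "A \<in> carrier_mat n n"
    and "\<And>i j. i < j \<Longrightarrow> j < n \<Longrightarrow> A $$ (i, j) = 0"
    and "\<And>i. i < n \<Longrightarrow> A $$ (i, i) = 1"
  shows "det A = 1"
proof -
  have "det A = prod_list (diag_mat A)"
    using det_lower_triangular assms(1,2) by blast
  also have "\<dots> = 1"
    using assms(1,3) by (simp add: prod_list_diag_prod)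
  finally show ?thesis .
qed

text \<open>The inverse is the adjugate, so its entries stay in the ring. This keeps the factor
  \<open>L\<close> below polynomial.\<close>

lemma unimodular_right_inverse:
  fixes T :: "'a::comm_ring_1 mat"
  assumes T: "T \<in> carrier_mat r r" and "det T = 1"
  obtains U where "U \<in> carrier_mat r r" "U * T = 1\<^sub>m r" "det U = 1"
proof
  show U: "adj_mat T \<in> carrier_mat r r" using adj_mat(1)[OF T] .
  show inv: "adj_mat T * T = 1\<^sub>m r"
    using adj_mat(3)[OF T] assms(2) by (auto intro!: eq_matI)
  show "det (adj_mat T) = 1"
    using arg_cong[OF inv, of det] assms(2) by (simp add: det_mult[OF U T])
qed

text \<open>
  The block column \<open>S\<close> solves \<open>M S = (P, 0)\<close> with leading block 1: putting it in place of the first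
  block column of the identity gives \<open>Q\<close>, so that \<open>M Q\<close> is block upper triangular.
\<close>

lemma block_diagonalization:
  fixes M :: "'a::idom mat" and S :: "nat \<Rightarrow> nat \<Rightarrow> 'a"
  assumes M: "M \<in> carrier_mat (k + r) (k + r)" and P: "P \<in> carrier_mat k k"
    and S: "\<And>i j. i < k \<Longrightarrow> j < k \<Longrightarrow> S i j = (if i = j then 1 else 0)"
    and MS: "\<And>i j. i < k + r \<Longrightarrow> j < k \<Longrightarrow>
      (\<Sum>l<k + r. M $$ (i, l) * S l j) = (if i < k then P $$ (i, j) else 0)"
    and upper: "\<And>i j. k \<le> i \<Longrightarrow> i < j \<Longrightarrow> j < k + r \<Longrightarrow> M $$ (i, j) = 0"
    and diag: "\<And>i. k \<le> i \<Longrightarrow> i < k + r \<Longrightarrow> M $$ (i, i) = 1"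
  shows "\<exists>L \<in> carrier_mat (k + r) (k + r). \<exists>Q \<in> carrier_mat (k + r) (k + r).
    det L = 1 \<and> det Q = 1 \<and>
    L * M * Q = four_block_mat P (0\<^sub>m k r) (0\<^sub>m r k) (1\<^sub>m r)"
proof -
  define Q where
    "Q = mat (k + r) (k + r) (\<lambda>(i, j). if j < k then S i j else if i = j then 1 else 0)"
  \<comment> \<open>The columns of \<open>Q\<close> from \<open>k\<close> on are those of the
    identity, so \<open>M * Q\<close> keeps the right block column of \<open>M\<close>, which
    consists of \<open>N\<close> above \<open>T\<close>.\<close>
  define N where "N = mat k r (\<lambda>(i, j). M $$ (i, k + j))"
  define T where "T = mat r r (\<lambda>(i, j). M $$ (k + i, k + j))"
  have Q: "Q \<in> carrier_mat (k + r) (k + r)" and N: "N \<in> carrier_mat k r"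
    and T: "T \<in> carrier_mat r r"
    by (simp_all add: Q_def N_def T_def)
  have detQ: "det Q = 1"
    by (rule det_lower_unitriangular[OF Q]) (auto simp: Q_def S)
  have "det T = 1"
    by (rule det_lower_unitriangular[OF T]) (auto simp: T_def upper diag)
  then obtain U where U: "U \<in> carrier_mat r r" "U * T = 1\<^sub>m r" "det U = 1"
    using unimodular_right_inverse[OF T] by blast
  have MQ: "M * Q = four_block_mat P N (0\<^sub>m r k) T"
  proof (rule eq_matI)
    fix i j
    assume "i < dim_row (four_block_mat P N (0\<^sub>m r k) T)"
      and "j < dim_col (four_block_mat P N (0\<^sub>m r k) T)"
    then have ij: "i < k + r" "j < k + r" using P T by auto
    have "(M * Q) $$ (i, j) = (\<Sum>l<k + r. M $$ (i, l) * Q $$ (l, j))"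
      using M Q ij by (simp add: scalar_prod_def atLeast0LessThan)
    also have "\<dots> = four_block_mat P N (0\<^sub>m r k) T $$ (i, j)"
    proof (cases "j < k")
      case True
      then have "(\<Sum>l<k + r. M $$ (i, l) * Q $$ (l, j)) = (\<Sum>l<k + r. M $$ (i, l) * S l j)"
        by (intro sum.cong) (auto simp: Q_def)
      then show ?thesis using MS[OF ij(1) True] True ij P T by auto
    next
      case False
      then have "(\<Sum>l<k + r. M $$ (i, l) * Q $$ (l, j)) =
          (\<Sum>l<k + r. if l = j then M $$ (i, l) else 0)"
        using ij by (intro sum.cong) (auto simp: Q_def)
      then show ?thesis using False ij P T by (auto simp: N_def T_def)
    qed
    finally show "(M * Q) $$ (i, j) = four_block_mat P N (0\<^sub>m r k) T $$ (i, j)" .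
  qed (use M Q P T in auto)
  \<comment> \<open>Multiplying by \<open>L\<close> from the left turns \<open>T\<close> into
    \<open>U * T = 1\<close> and \<open>N\<close> into \<open>N - N * U * T = 0\<close>, while the
    first block column \<open>(P, 0)\<close> is unchanged.\<close>
  define L where "L = four_block_mat (1\<^sub>m k) (- (N * U)) (0\<^sub>m r k) U"
  have L: "L \<in> carrier_mat (k + r) (k + r)"
    using U(1) by (simp add: L_def)
  have NU: "- (N * U) \<in> carrier_mat k r" using N U by auto
  have "det L = 1"
    unfolding L_def using NU U by (subst det_four_block_mat_lower_left_zero) auto
  have "N * U * T = N"
    using assoc_mult_mat[OF N U(1) T] U(2) N by simp
  then have "- (N * U) * T = - N"
    using N U(1) T by simp
  moreover have "N + - N = 0\<^sub>m k r"
    using N by auto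
  ultimately have "L * (M * Q) = four_block_mat P (0\<^sub>m k r) (0\<^sub>m r k) (1\<^sub>m r)"
    unfolding MQ L_def using P N T U NU
    by (subst mult_four_block_mat[where ?nr1.0 = k and ?nr2.0 = r and ?n1.0 = k and ?n2.0 = r
          and ?nc1.0 = k and ?nc2.0 = r]) auto
  then show ?thesis
    using \<open>det L = 1\<close> L Q detQ M by (intro bexI[of _ L] bexI[of _ Q]) auto
qed

section \<open>The tree\<close>

definition tree_nodes :: "nat \<Rightarrow> monomial set" where
  "tree_nodes n = {(j, l). j + l < n \<and> (l = 0 \<or> even j)}"

lemma finite_tree_nodes [simp]: "finite (tree_nodes n)"
  by (rule finite_subset[of _ "{..<n} \<times> {..<n}"]) (auto simp: tree_nodes_def)

lemma verts_monomial_tree [simp]: "verts (monomial_tree n) = tree_nodes n"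
  by (simp add: monomial_tree_def tree_nodes_def)

lemma arcs_monomial_tree:
  "arcs (monomial_tree n) =
     {(s, t). s \<in> tree_nodes n \<and> t \<in> tree_nodes n \<and> (x_edge s t \<or> y_edge s t)}"
  by (auto simp: monomial_tree_def tree_nodes_def monomial_graph_def)

lemma tail_monomial_tree [simp]: "tail (monomial_tree n) = fst"
  and head_monomial_tree [simp]: "head (monomial_tree n) = snd"
  by (simp_all add: monomial_tree_def)

lemma dominates_monomial_tree:
  "s \<rightarrow>\<^bsub>monomial_tree n\<^esub> t \<longleftrightarrow>
     s \<in> tree_nodes n \<and> t \<in> tree_nodes n \<and> (x_edge s t \<or> y_edge s t)"
  by (auto simp: arcs_ends_def arc_to_ends_def arcs_monomial_tree image_iff)

lemma wf_monomial_tree: "wf_digraph (monomial_tree n)"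
  by unfold_locales (auto simp: arcs_monomial_tree)

text \<open>If \<open>snd t = 0\<close>, no y-edge can enter \<open>t\<close>. Otherwise the
  exponent of \<open>x\<close> in \<open>t\<close> is even, so an x-predecessor would have an odd
  exponent of \<open>x\<close> and a positive exponent of \<open>y\<close>, which the node set
  excludes; only the y-predecessor remains.\<close>

lemma ex1_predecessor:
  assumes "t \<in> tree_nodes n" "t \<noteq> (0, 0)"
  shows "\<exists>!s. s \<in> tree_nodes n \<and> (x_edge s t \<or> y_edge s t)"
proof (cases "snd t")
  case 0
  then obtain j where "t = (Suc j, 0)" using assms by (cases t; cases "fst t") auto
  then show ?thesis using assms
    by (intro ex1I[of _ "(j, 0)"]) (auto simp: tree_nodes_def x_edge_def y_edge_def)
next
  case (Suc l)
  then obtain j where "t = (j, Suc l)" by (cases t) auto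
  then show ?thesis using assms
    by (intro ex1I[of _ "(j, l)"]) (auto simp: tree_nodes_def x_edge_def y_edge_def)
qed

section \<open>Unique directed walks from the root\<close>

text \<open>Ranks grow along arcs, which allows induction on the rank of the end node. Away from the
  root the last arc of a walk is forced, and what precedes it is the unique walk to its tail. No arc
  enters the root, so only the empty walk ends there.\<close>

lemma rooted_directed_treeI:
  fixes rank :: "'a \<Rightarrow> nat"
  assumes wf: "wf_digraph G" and r: "r \<in> verts G"
    and root: "\<And>e. e \<in> arcs G \<Longrightarrow> head G e \<noteq> r"
    and pred: "\<And>v. v \<in> verts G \<Longrightarrow> v \<noteq> r \<Longrightarrow> \<exists>!e. e \<in> arcs G \<and> head G e = v"
    and rank: "\<And>e. e \<in> arcs G \<Longrightarrow> rank (tail G e) < rank (head G e)"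
  shows "rooted_directed_tree G r"
proof -
  interpret wf_digraph G by (rule wf)
  have "\<exists>!p. awalk r p v" if "v \<in> verts G" for v
    using that
  proof (induction "rank v" arbitrary: v rule: less_induct)
    case less
    have last_arc: "\<exists>p' e. p = p' @ [e] \<and> awalk r p' (tail G e) \<and> e \<in> arcs G \<and> head G e = v"
      if "awalk r p v" "p \<noteq> []" for p
    proof -
      obtain p' e where p: "p = p' @ [e]" using \<open>p \<noteq> []\<close> by (metis rev_exhaust)
      then show ?thesis using that by (auto simp: awalk_simps)
    qed
    show ?case
    proof (cases "v = r")
      case True
      show ?thesis
      proof (rule ex1I[of _ "[]"])
        show "awalk r [] v" using True r by (simp add: awalk_Nil_iff)
        show "p = []" if "awalk r p v" for p using last_arc[OF that] root True by blast
      qed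
    next
      case False
      then obtain e where e: "e \<in> arcs G" "head G e = v"
        and uniq: "\<And>e'. e' \<in> arcs G \<Longrightarrow> head G e' = v \<Longrightarrow> e' = e"
        using pred[OF less.prems] by blast
      have "\<exists>!p. awalk r p (tail G e)"
        using less.hyps rank[OF e(1)] e by auto
      then obtain p where p: "awalk r p (tail G e)"
        and uniqp: "\<And>p'. awalk r p' (tail G e) \<Longrightarrow> p' = p"
        by blast
      show ?thesis
      proof (rule ex1I[of _ "p @ [e]"])
        show "awalk r (p @ [e]) v"
          using awalk_appendI[OF p arc_implies_awalk[OF e(1)]] e(2) by simp
        fix p' assume p': "awalk r p' v"
        then have "p' \<noteq> []" using False by (auto simp: awalk_Nil_iff)
        then show "p' = p @ [e]" using last_arc[OF p'] uniq uniqp by blast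
      qed
    qed
  qed
  then show ?thesis using wf r by (simp add: rooted_directed_tree_def)
qed

lemma rooted_directed_monomial_tree:
  assumes "n \<ge> 1"
  shows "rooted_directed_tree (monomial_tree n) (0, 0)"
proof (rule rooted_directed_treeI[where rank = "\<lambda>v. fst v + snd v"])
  show "(0, 0) \<in> verts (monomial_tree n)" using assms by (simp add: tree_nodes_def)
next
  fix v assume v: "v \<in> verts (monomial_tree n)" "v \<noteq> (0, 0)"
  then have "v \<in> tree_nodes n" by simp
  from ex1_predecessor[OF this v(2)] obtain u
    where u: "u \<in> tree_nodes n" "x_edge u v \<or> y_edge u v"
      and uniq: "\<And>w. w \<in> tree_nodes n \<Longrightarrow> x_edge w v \<or> y_edge w v \<Longrightarrow> w = u"
    by blast
  show "\<exists>!e. e \<in> arcs (monomial_tree n) \<and> head (monomial_tree n) e = v"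
  proof (rule ex1I[of _ "(u, v)"])
    show "(u, v) \<in> arcs (monomial_tree n) \<and> head (monomial_tree n) (u, v) = v"
      using u v by (simp add: arcs_monomial_tree)
    fix e assume "e \<in> arcs (monomial_tree n) \<and> head (monomial_tree n) e = v"
    then show "e = (u, v)" using uniq[of "fst e"]
      by (cases e) (auto simp: arcs_monomial_tree)
  qed
qed (auto simp: wf_monomial_tree arcs_monomial_tree x_edge_def y_edge_def)

section \<open>The number of nodes\<close>

lemma psi_add_2: "psi (n + 2) = psi n + (n + 3)"
proof (cases "even n")
  case True
  then obtain a where "n = 2 * a" ..
  \<comment> \<open>Writing the numerators as explicit multiples of 4 makes the truncating division
    exact.\<close>
  moreover have "2 * a * (2 * a + 4) = 4 * (a * (a + 2))"
    and "(2 * a + 2) * (2 * a + 2 + 4) = 4 * (a * (a + 2) + (2 * a + 3))"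
    by (simp_all add: algebra_simps)
  ultimately show ?thesis by (simp only: psi_def) simp
next
  case False
  then obtain a where "n = 2 * a + 1" by (rule oddE)
  moreover have "(2 * a + 1 - 1) * (2 * a + 1 + 5) = 4 * (a * (a + 3))"
    and "(2 * a + 1 + 2 - 1) * (2 * a + 1 + 2 + 5) = 4 * (a * (a + 3) + (2 * a + 4))"
    by (simp_all add: algebra_simps)
  ultimately show ?thesis by (simp only: psi_def) simp
qed

text \<open>Multiplication by \<open>x^2\<close> preserves the parity condition and embeds the nodes
  for \<open>n\<close> into those for \<open>n + 2\<close>. The nodes missed are the
  \<open>n + 2\<close> powers of \<open>y\<close> and the single node \<open>x\<close>, which
  matches \<open>psi_add_2\<close>.\<close>

lemma card_tree_nodes: "card (tree_nodes n) = psi n"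
proof (induction n rule: nat_induct2)
  case 0
  have "tree_nodes 0 = {}" by (auto simp: tree_nodes_def)
  then show ?case by (simp add: psi_def)
next
  case 1
  have "tree_nodes 1 = {(0, 0)}" by (auto simp: tree_nodes_def)
  then show ?case by (simp add: psi_def)
next
  case (step n)
  let ?shift = "\<lambda>(j, l). (j + 2, l)" and ?first = "{0} \<times> {..<n + 2} \<union> {(1::nat, 0)}"
  have "tree_nodes (n + 2) = ?shift ` tree_nodes n \<union> ?first" (is "?lhs = ?rhs")
  proof (rule Set.set_eqI, unfold split_paired_all)
    fix j l :: nat
    consider "j = 0" | "j = 1" | i where "j = i + 2"
      by (metis One_nat_def add_2_eq_Suc' not0_implies_Suc)
    then show "(j, l) \<in> ?lhs \<longleftrightarrow> (j, l) \<in> ?rhs"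
      by cases (auto simp: tree_nodes_def image_iff)
  qed
  moreover have "card (?shift ` tree_nodes n) = card (tree_nodes n)"
    by (rule card_image) (auto simp: inj_on_def)
  moreover have "card ?first = n + 3"
    by (subst card_Un_disjoint) (auto simp: card_cartesian_product)
  moreover have "card (?shift ` tree_nodes n \<union> ?first) = card (?shift ` tree_nodes n) + card ?first"
    by (rule card_Un_disjoint) auto
  ultimately show ?case
    using step psi_add_2 by simp
qed

text \<open>The key has total degree and exponent of \<open>y\<close> as its two digits in base
  \<open>n\<close>, since exponents of nodes are below \<open>n\<close>. Within one degree a larger
  exponent of \<open>y\<close> means a smaller exponent of \<open>x\<close>, so increasing keys give
  the order \<open>precedes\<close>.\<close>

lemma ex_sorted_tree_nodes: "\<exists>s. set s = tree_nodes n \<and> sorted_wrt precedes s"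
proof -
  let ?key = "\<lambda>v::monomial. (fst v + snd v) * n + snd v"
  obtain xs where xs: "set xs = tree_nodes n" "distinct xs"
    using finite_distinct_list[OF finite_tree_nodes] by blast
  define s where "s = sort_key ?key xs"
  have set_s: "set s = tree_nodes n" and "distinct s" using xs by (simp_all add: s_def)
  have key: "?key u < ?key v \<Longrightarrow> precedes u v"
    if "u \<in> tree_nodes n" "v \<in> tree_nodes n" for u v
  proof (rule ccontr)
    assume less: "?key u < ?key v" and not: "\<not> precedes u v"
    have "snd v < n" using that by (auto simp: tree_nodes_def)
    have "fst v + snd v < fst u + snd u \<or> fst v + snd v = fst u + snd u \<and> snd v \<le> snd u"
      using not by (auto simp: precedes_def)
    then show False
    proof (elim disjE conjE)
      assume "fst v + snd v < fst u + snd u"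
      then have "(fst v + snd v + 1) * n \<le> (fst u + snd u) * n"
        by (intro mult_right_mono) auto
      then show False using less \<open>snd v < n\<close> by simp
    qed (use less in simp)
  qed
  \<comment> \<open>Sorting yields only weakly increasing keys; injectivity makes them strictly
    increasing. The two digits are recovered by \<open>div n\<close> and
    \<open>mod n\<close>.\<close>
  have "inj_on ?key (tree_nodes n)"
  proof (rule inj_onI)
    fix u v assume uv: "u \<in> tree_nodes n" "v \<in> tree_nodes n" "?key u = ?key v"
    then have "snd u < n" "snd v < n" by (auto simp: tree_nodes_def)
    then have "?key u mod n = snd u" "?key v mod n = snd v"
      and "?key u div n = fst u + snd u" "?key v div n = fst v + snd v" by auto
    then show "u = v" using uv(3) by (metis add_right_cancel prod_eqI)
  qed
  then have "sorted_wrt (<) (map ?key s)"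
    using \<open>distinct s\<close> set_s by (simp add: strict_sorted_iff distinct_map s_def)
  then have "sorted_wrt (\<lambda>u v. ?key u < ?key v) s" by (simp add: sorted_wrt_map)
  then have "sorted_wrt precedes s"
    by (rule sorted_wrt_mono_rel[rotated]) (use key set_s in auto)
  then show ?thesis using set_s by blast
qed

section \<open>The pencil\<close>

text \<open>
  Every monomial of degree at most \<open>n\<close> other than 1 is charged to one node of the tree, by a
  last step along \<open>x\<close> if its exponent of \<open>x\<close> is odd or that of \<open>y\<close> vanishes, along \<open>y\<close> otherwise.
\<close>

lemma sum_tree_nodes:
  fixes f :: "nat \<Rightarrow> nat \<Rightarrow> 'a::comm_monoid_add"
  assumes "n \<ge> 1"
  shows "(\<Sum>i=0..n. \<Sum>j=0..n - i. f i j) =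
    f 0 0 + (\<Sum>(a, b)\<in>tree_nodes n. f (Suc a) b + (if even a then f a (Suc b) else 0))"
proof -
  let ?V = "tree_nodes n" and ?E = "{v \<in> tree_nodes n. even (fst v)}"
  let ?f = "\<lambda>(i, j). f i j"
  let ?X = "(\<lambda>(a, b). (Suc a, b)) ` ?V" and ?Y = "(\<lambda>(a, b). (a, Suc b)) ` ?E"
  have split: "(SIGMA i:{0..n}. {0..n - i}) = {(0, 0)} \<union> (?X \<union> ?Y)"
  proof (rule Set.set_eqI, unfold split_paired_all)
    fix i j
    show "(i, j) \<in> (SIGMA i:{0..n}. {0..n - i}) \<longleftrightarrow> (i, j) \<in> {(0, 0)} \<union> (?X \<union> ?Y)"
      using assms by (cases i; cases j) (auto simp: tree_nodes_def image_iff)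
  qed
  have "(\<Sum>i=0..n. \<Sum>j=0..n - i. f i j) = sum ?f ({(0, 0)} \<union> (?X \<union> ?Y))"
    by (simp add: sum.Sigma split)
  also have "\<dots> = f 0 0 + (sum ?f ?X + sum ?f ?Y)"
  proof -
    \<comment> \<open>A point of \<open>?X\<close> with positive exponent of \<open>y\<close> has an
      odd exponent of \<open>x\<close>, whereas points of \<open>?Y\<close> have an even exponent of
      \<open>x\<close> and a positive exponent of \<open>y\<close>.\<close>
    have "(0, 0) \<notin> ?X \<union> ?Y" and "?X \<inter> ?Y = {}" by (auto simp: tree_nodes_def)
    then show ?thesis by (simp add: sum.union_disjoint)
  qed
  also have "sum ?f ?X = (\<Sum>(a, b)\<in>?V. f (Suc a) b)"
    by (subst sum.reindex) (auto simp: inj_on_def intro!: sum.cong)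
  also have "sum ?f ?Y = (\<Sum>(a, b)\<in>?E. f a (Suc b))"
    by (subst sum.reindex) (auto simp: inj_on_def intro!: sum.cong)
  also have "\<dots> = (\<Sum>(a, b)\<in>?V. if even a then f a (Suc b) else 0)"
    by (rule sum.mono_neutral_cong_left) (auto split: if_splits)
  finally show ?thesis by (simp add: sum.distrib split_def)
qed

text \<open>The second factor is column \<open>b\<close> of the block column with scalar blocks
  \<open>g p\<close> times the identity: each group of \<open>k\<close> consecutive indices
  contributes one term.\<close>

lemma sum_block_column:
  fixes f :: "nat \<Rightarrow> 'a::semiring_0"
  assumes "b < k"
  shows "(\<Sum>l<m * k. f l * (if l mod k = b then g (l div k) else 0)) =
    (\<Sum>p<m. f (p * k + b) * g p)"
proof -
  have "(\<Sum>l<m * k. f l * (if l mod k = b then g (l div k) else 0)) =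
    (\<Sum>p<m. \<Sum>l=p * k..<p * k + k. f l * (if l mod k = b then g (l div k) else 0))"
    by (rule sum.nat_group[symmetric])
  also have "\<dots> = (\<Sum>p<m. f (p * k + b) * g p)"
  proof (rule sum.cong[OF refl])
    fix p
    have "(\<Sum>l=p * k..<p * k + k. f l * (if l mod k = b then g (l div k) else 0)) =
      (\<Sum>c=0..<k. f (c + p * k) * (if (c + p * k) mod k = b then g ((c + p * k) div k) else 0))"
      using sum.shift_bounds_nat_ivl[of "\<lambda>l. f l * (if l mod k = b then g (l div k) else 0)"
          0 "p * k" k]
      by (simp add: add.commute)
    also have "\<dots> = (\<Sum>c=0..<k. if c = b then f (p * k + b) * g p else 0)"
      by (rule sum.cong) (auto simp: add.commute)
    finally show "(\<Sum>l=p * k..<p * k + k. f l * (if l mod k = b then g (l div k) else 0)) =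
      f (p * k + b) * g p" using assms by simp
  qed
  finally show ?thesis .
qed

lemma block_index_eq_iff:
  fixes a b k q r :: nat
  assumes "a < k" "b < k"
  shows "q * k + a = r * k + b \<longleftrightarrow> q = r \<and> a = b"
  using assms by (metis Euclidean_Rings.div_eq_0_iff add.right_neutral add_left_cancel
      div_mult_self3 not_less0)

lemma dim_matrix_poly [simp]:
  "dim_row (matrix_poly n k P) = k" "dim_col (matrix_poly n k P) = k"
  by (simp_all add: matrix_poly_def)

lemma bconst_simps [simp]:
  "bconst 0 = 0" "bconst 1 = 1" "bconst (- 1) = - 1"
  by (simp_all add: bconst_def one_pCons)

lemma monomial_poly_0 [simp]: "monomial_poly (0, 0) = 1"
  by (simp add: monomial_poly_def)

lemma monomial_poly_edge:
  "x_edge s t \<Longrightarrow> monomial_poly t = bvarx * monomial_poly s"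
  "y_edge s t \<Longrightarrow> monomial_poly t = bvary * monomial_poly s"
  by (simp_all add: monomial_poly_def x_edge_def y_edge_def mult_ac)

section \<open>Nodes as block indices\<close>

locale ordered_tree =
  fixes n k :: nat and P :: "nat \<Rightarrow> nat \<Rightarrow> complex mat" and s :: "monomial list"
  assumes n: "n \<ge> 1" and k: "k \<ge> 1"
    and set_s: "set s = tree_nodes n" and sorted_s: "sorted_wrt precedes s"
begin

abbreviation m :: nat where "m \<equiv> length s"

lemma distinct_s: "distinct s"
  using sorted_s by (induction s) (auto simp: precedes_def)

lemma node_s: "p < m \<Longrightarrow> s ! p \<in> tree_nodes n"
  using set_s nth_mem by blast

lemma root_in_s: "(0, 0) \<in> set s"
  using n set_s by (simp add: tree_nodes_def)

lemma m_pos: "m > 0"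
  using length_pos_if_in_set[OF root_in_s] .

lemma m_psi: "m = psi n"
  using card_tree_nodes distinct_card[OF distinct_s] set_s by simp

lemma s_0: "s ! 0 = (0, 0)"
proof -
  obtain p where p: "p < m" "s ! p = (0, 0)" using root_in_s by (metis in_set_conv_nth)
  then show ?thesis
    using sorted_wrt_nth_less[OF sorted_s, of 0 p] by (cases "p = 0") (auto simp: precedes_def)
qed

text \<open>The predecessor has total degree one less, so it comes earlier in the list. The
  resulting \<open>p < q\<close> places the edge blocks of the pencil below the diagonal.\<close>

lemma ex_predecessor:
  assumes "1 \<le> q" "q < m"
  obtains p where "p < q" "x_edge (s ! p) (s ! q) \<or> y_edge (s ! p) (s ! q)"
    and "\<And>r. r < m \<Longrightarrow> x_edge (s ! r) (s ! q) \<or> y_edge (s ! r) (s ! q) \<longleftrightarrow> r = p"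
proof -
  have "s ! q \<noteq> (0, 0)"
    using assms distinct_s s_0 m_pos nth_eq_iff_index_eq[of s q 0] by auto
  then obtain v where v: "v \<in> tree_nodes n" "x_edge v (s ! q) \<or> y_edge v (s ! q)"
    and uniq: "\<And>u. u \<in> tree_nodes n \<Longrightarrow> x_edge u (s ! q) \<or> y_edge u (s ! q) \<Longrightarrow> u = v"
    using ex1_predecessor[OF node_s[OF assms(2)]] by blast
  obtain p where p: "p < m" "s ! p = v" using v set_s by (metis in_set_conv_nth)
  have "p < q"
  proof (rule ccontr)
    assume "\<not> p < q"
    then have "p = q \<or> precedes (s ! q) (s ! p)"
      using sorted_wrt_nth_less[OF sorted_s] p by (metis linorder_cases)
    then show False using v p by (auto simp: precedes_def x_edge_def y_edge_def prod_eq_iff)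
  qed
  moreover have "x_edge (s ! r) (s ! q) \<or> y_edge (s ! r) (s ! q) \<longleftrightarrow> r = p" if "r < m" for r
    using that uniq[OF node_s[OF that]] p v distinct_s by (auto simp: nth_eq_iff_index_eq)
  ultimately show thesis using that v p by blast
qed

section \<open>The coefficient matrices and the entries of the pencil\<close>

text \<open>The first block rows of the three matrices distribute the coefficients of
  \<open>P\<close> as in \<open>sum_tree_nodes\<close>: the constant one goes here, the others into
  \<open>pencil_B\<close> or \<open>pencil_C\<close> according to the last step, in the block column
  of the node where that step starts.\<close>

definition pencil_A :: "complex mat" where
  "pencil_A = mat (m * k) (m * k) (\<lambda>(i, j).
     if i < k then if j < k then P 0 0 $$ (i, j) else 0
     else if i = j then 1 else 0)"

definition pencil_B :: "complex mat" where
  "pencil_B = mat (m * k) (m * k) (\<lambda>(i, j). let v = s ! (j div k) in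
     if i < k then P (Suc (fst v)) (snd v) $$ (i, j mod k)
     else if i mod k = j mod k \<and> x_edge v (s ! (i div k)) then - 1 else 0)"

text \<open>The default 0 at a node with odd exponent \<open>a\<close> of \<open>x\<close> prevents
  double counting: such a node is \<open>x^a\<close>, and the coefficient of \<open>x^a y\<close>
  already stands in \<open>pencil_B\<close> at the node \<open>x^(a-1) y\<close>.\<close>

definition pencil_C :: "complex mat" where
  "pencil_C = mat (m * k) (m * k) (\<lambda>(i, j). let v = s ! (j div k) in
     if i < k then if even (fst v) then P (fst v) (Suc (snd v)) $$ (i, j mod k) else 0
     else if i mod k = j mod k \<and> y_edge v (s ! (i div k)) then - 1 else 0)"

abbreviation M :: "bipoly mat" where
  "M \<equiv> linear_pencil pencil_A pencil_B pencil_C"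

lemma pencil_carrier [simp]:
  "pencil_A \<in> carrier_mat (m * k) (m * k)" "pencil_B \<in> carrier_mat (m * k) (m * k)"
  "pencil_C \<in> carrier_mat (m * k) (m * k)" "M \<in> carrier_mat (m * k) (m * k)"
  by (simp_all add: pencil_A_def pencil_B_def pencil_C_def linear_pencil_def)

lemma index_bound:
  assumes "p < m" "b < k"
  shows "p * k + b < m * k"
proof -
  have "p * k + b < Suc p * k" using assms by simp
  also have "\<dots> \<le> m * k" using assms by (intro mult_right_mono) auto
  finally show ?thesis .
qed

lemma M_first_row:
  assumes "a < k" "b < k" "p < m"
  shows "M $$ (a, p * k + b) =
    (if p = 0 then bconst (P 0 0 $$ (a, b)) else 0)
    + bvarx * bconst (P (Suc (fst (s ! p))) (snd (s ! p)) $$ (a, b))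
    + (if even (fst (s ! p)) then bvary * bconst (P (fst (s ! p)) (Suc (snd (s ! p))) $$ (a, b))
       else 0)"
proof -
  have "a < m * k" using index_bound[OF m_pos assms(1)] by simp
  moreover have "p * k + b < k \<longleftrightarrow> p = 0" using assms by (cases p) auto
  ultimately show ?thesis using index_bound[OF assms(3,2)] assms
    by (auto simp: linear_pencil_def pencil_A_def pencil_B_def pencil_C_def Let_def)
qed

lemma M_tree_row:
  assumes "1 \<le> q" "q < m" "a < k" "b < k" "r < m"
    and "p < q" "x_edge (s ! p) (s ! q) \<or> y_edge (s ! p) (s ! q)"
    and uniq: "\<And>r. r < m \<Longrightarrow> x_edge (s ! r) (s ! q) \<or> y_edge (s ! r) (s ! q) \<longleftrightarrow> r = p"
  shows "M $$ (q * k + a, r * k + b) =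
    (if a \<noteq> b then 0 else if r = q then 1
     else if r = p then if x_edge (s ! p) (s ! q) then - bvarx else - bvary else 0)"
proof -
  have "\<not> q * k + a < k" using assms by (cases q) auto
  moreover have "q * k + a = r * k + b \<longleftrightarrow> q = r \<and> a = b"
    using block_index_eq_iff[OF assms(3,4)] .
  \<comment> \<open>This rules out an entry to which \<open>pencil_B\<close> and
    \<open>pencil_C\<close> both contribute.\<close>
  moreover have "\<not> (x_edge u v \<and> y_edge u v)" for u v
    by (auto simp: x_edge_def y_edge_def)
  ultimately show ?thesis
    using index_bound[of q a] index_bound[of r b] assms(1-7) uniq[OF assms(5)]
    by (auto simp: linear_pencil_def pencil_A_def pencil_B_def pencil_C_def Let_def)
qed

section \<open>The pencil applied to the column of monomials\<close>

text \<open>Multiplying a coefficient in the block column of a node by the node and by the variable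
  of the last step restores its full monomial, so the sum is the regrouping of \<open>P\<close> in
  \<open>sum_tree_nodes\<close>.\<close>

lemma first_row_sum:
  assumes "a < k" "b < k"
  shows "(\<Sum>p<m. monomial_poly (s ! p) * M $$ (a, p * k + b)) = matrix_poly n k P $$ (a, b)"
proof -
  let ?f = "\<lambda>i j. bvarx ^ i * bvary ^ j * bconst (P i j $$ (a, b))"
  let ?g = "\<lambda>(i, j). ?f (Suc i) j + (if even i then ?f i (Suc j) else 0)"
  have "(\<Sum>p<m. monomial_poly (s ! p) * M $$ (a, p * k + b)) =
    (\<Sum>p<m. (if p = 0 then ?f 0 0 else 0) + ?g (s ! p))"
  proof (rule sum.cong[OF refl])
    fix p assume "p \<in> {..<m}"
    then have p: "p < m" by simp
    show "monomial_poly (s ! p) * M $$ (a, p * k + b) = (if p = 0 then ?f 0 0 else 0) + ?g (s ! p)"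
      unfolding M_first_row[OF assms p]
      by (auto simp: s_0 monomial_poly_def split_def algebra_simps)
  qed
  also have "\<dots> = ?f 0 0 + (\<Sum>p<m. ?g (s ! p))"
    using m_pos by (simp add: sum.distrib)
  also have "(\<Sum>p<m. ?g (s ! p)) = sum ?g (tree_nodes n)"
    by (rule sum.reindex_bij_betw) (simp add: bij_betw_nth distinct_s set_s)
  also have "?f 0 0 + sum ?g (tree_nodes n) = matrix_poly n k P $$ (a, b)"
    using assms by (simp add: matrix_poly_def sum_tree_nodes[OF n])
  finally show ?thesis .
qed

text \<open>On the diagonal of a block the row evaluates to the monomial of \<open>s ! q\<close>
  minus the edge variable times that of its predecessor, and these two are equal.\<close>

lemma tree_row_sum:
  assumes "1 \<le> q" "q < m" "a < k" "b < k"
  shows "(\<Sum>p<m. monomial_poly (s ! p) * M $$ (q * k + a, p * k + b)) = 0"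
proof -
  obtain p where p: "p < q" "x_edge (s ! p) (s ! q) \<or> y_edge (s ! p) (s ! q)"
    and uniq: "\<And>r. r < m \<Longrightarrow> x_edge (s ! r) (s ! q) \<or> y_edge (s ! r) (s ! q) \<longleftrightarrow> r = p"
    using ex_predecessor[OF assms(1,2)] by blast
  let ?c = "if x_edge (s ! p) (s ! q) then bvarx else bvary"
  have "(\<Sum>r<m. monomial_poly (s ! r) * M $$ (q * k + a, r * k + b)) =
    (\<Sum>r<m. (if r = q then if a = b then monomial_poly (s ! q) else 0 else 0)
      - (if r = p then if a = b then ?c * monomial_poly (s ! p) else 0 else 0))"
    by (rule sum.cong) (use M_tree_row[OF assms _ p uniq] p in auto)
  also have "\<dots> = (if a = b then monomial_poly (s ! q) else 0)
      - (if a = b then ?c * monomial_poly (s ! p) else 0)"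
    using assms p by (simp add: sum_subtractf)
  also have "\<dots> = 0" using p(2) by (auto simp: monomial_poly_edge)
  finally show ?thesis .
qed

lemma index_split:
  assumes "k \<le> i" "i < m * k"
  obtains q a where "i = q * k + a" "1 \<le> q" "q < m" "a < k"
proof
  show "i = i div k * k + i mod k" by simp
  show "1 \<le> i div k" "i div k < m" "i mod k < k"
    using assms k by (simp_all add: Suc_leI div_greater_zero_iff less_mult_imp_div_less)
qed

section \<open>Linearization along the tree\<close>

lemma M_is_linearization:
  "is_linearization (m * k) k pencil_A pencil_B pencil_C (matrix_poly n k P)"
proof -
  obtain r where r: "m * k = k + r"
    using m_pos by (cases m) auto
  \<comment> \<open>This is the block column of all node monomials times the identity; its leading
    block is the identity because \<open>s ! 0\<close> is the monomial 1.\<close>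
  let ?S = "\<lambda>i b. if i mod k = b then monomial_poly (s ! (i div k)) else 0"
  have MS: "(\<Sum>l<k + r. M $$ (i, l) * ?S l b) = (if i < k then matrix_poly n k P $$ (i, b) else 0)"
    if i: "i < k + r" and b: "b < k" for i b
  proof -
    have "(\<Sum>l<k + r. M $$ (i, l) * ?S l b) = (\<Sum>p<m. monomial_poly (s ! p) * M $$ (i, p * k + b))"
      unfolding r[symmetric] by (subst sum_block_column[OF b]) (simp add: mult.commute)
    also have "\<dots> = (if i < k then matrix_poly n k P $$ (i, b) else 0)"
    proof (cases "i < k")
      case True
      then show ?thesis using first_row_sum b by simp
    next
      case False
      then obtain q a where "i = q * k + a" "1 \<le> q" "q < m" "a < k"
        using index_split[of i] i r by (metis leI)
      then show ?thesis using tree_row_sum b False by auto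
    qed
    finally show ?thesis .
  qed
  have unitriangular: "M $$ (i, j) = (if i = j then 1 else 0)"
    if ij: "k \<le> i" "i \<le> j" "j < k + r" for i j
  proof -
    obtain q a where q: "i = q * k + a" "1 \<le> q" "q < m" "a < k"
      by (rule index_split[of i]) (use ij r in auto)
    obtain q' b where q': "j = q' * k + b" "1 \<le> q'" "q' < m" "b < k"
      by (rule index_split[of j]) (use ij r in auto)
    obtain p where p: "p < q" "x_edge (s ! p) (s ! q) \<or> y_edge (s ! p) (s ! q)"
      and uniq: "\<And>r. r < m \<Longrightarrow> x_edge (s ! r) (s ! q) \<or> y_edge (s ! r) (s ! q) \<longleftrightarrow> r = p"
      using ex_predecessor[OF q(2,3)] by blast
    \<comment> \<open>Together with \<open>p < q\<close> this excludes \<open>q' = p\<close>, so on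
      and above the diagonal only the identity block of the row is met.\<close>
    have "q \<le> q'"
      using div_le_mono[OF ij(2), of k] q q' by simp
    then show ?thesis
      using M_tree_row[OF q(2,3,4) q'(4,3) p uniq] p q q' ij
        block_index_eq_iff[OF q(4) q'(4), of q q'] by auto
  qed
  have "\<exists>L \<in> carrier_mat (k + r) (k + r). \<exists>Q \<in> carrier_mat (k + r) (k + r).
      det L = 1 \<and> det Q = 1 \<and>
      L * M * Q = four_block_mat (matrix_poly n k P) (0\<^sub>m k r) (0\<^sub>m r k) (1\<^sub>m r)"
    by (rule block_diagonalization[where S = ?S])
      (use pencil_carrier r MS unitriangular in \<open>auto simp: s_0 matrix_poly_def\<close>)
  then show ?thesis
    unfolding is_linearization_def using pencil_carrier r by (simp add: matrix_poly_def)
qed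

lemma M_uses_tree:
  "uses_tree (monomial_tree n) k pencil_A pencil_B pencil_C (matrix_poly n k P)"
proof -
  have "\<exists>p<m. s ! p \<rightarrow>\<^bsub>monomial_tree n\<^esub> s ! q \<and>
      (\<forall>r<m. mat_block k M q r =
        (if r = q then 1\<^sub>m k
         else if r = p then (if x_edge (s ! p) (s ! q) then - bvarx else - bvary) \<cdot>\<^sub>m 1\<^sub>m k
         else 0\<^sub>m k k))" if q: "1 \<le> q" "q < m" for q
  proof -
    obtain p where p: "p < q" "x_edge (s ! p) (s ! q) \<or> y_edge (s ! p) (s ! q)"
      and uniq: "\<And>r. r < m \<Longrightarrow> x_edge (s ! r) (s ! q) \<or> y_edge (s ! r) (s ! q) \<longleftrightarrow> r = p"
      using ex_predecessor[OF q] by blast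
    have "mat_block k M q r =
        (if r = q then 1\<^sub>m k
         else if r = p then (if x_edge (s ! p) (s ! q) then - bvarx else - bvary) \<cdot>\<^sub>m 1\<^sub>m k
         else 0\<^sub>m k k)" if "r < m" for r
      by (rule eq_matI) (use M_tree_row[OF q _ _ that p uniq] in \<open>auto simp: mat_block_def\<close>)
    moreover have "s ! p \<rightarrow>\<^bsub>monomial_tree n\<^esub> s ! q"
      using p q node_s by (simp add: dominates_monomial_tree)
    ultimately show ?thesis using p q by (intro exI[of _ p]) auto
  qed
  moreover have "mat k k (\<lambda>ab. \<Sum>i<m. monomial_poly (s ! i) * mat_block k M 0 i $$ ab) =
      matrix_poly n k P"
    by (rule eq_matI) (simp_all add: mat_block_def first_row_sum)
  ultimately show ?thesis
    unfolding uses_tree_def Let_def using set_s sorted_s M_is_linearization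
    by (intro exI[of _ s]) simp
qed

end

theorem theorem5p2:
  fixes n k :: nat and P :: "nat \<Rightarrow> nat \<Rightarrow> complex mat"
  assumes "n \<ge> 1" and "k \<ge> 1"
    and "\<And>i j. i + j \<le> n \<Longrightarrow> P i j \<in> carrier_mat k k"
    and "\<exists>i j. i + j = n \<and> P i j \<noteq> 0\<^sub>m k k"
  shows "rooted_directed_tree (monomial_tree n) (0, 0) \<and>
    card (verts (monomial_tree n)) = psi n \<and>
    (\<exists>A B C. A \<in> carrier_mat (psi n * k) (psi n * k) \<and>
             B \<in> carrier_mat (psi n * k) (psi n * k) \<and>
             C \<in> carrier_mat (psi n * k) (psi n * k) \<and>
             is_linearization (psi n * k) k A B C (matrix_poly n k P) \<and>
             uses_tree (monomial_tree n) k A B C (matrix_poly n k P))"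
proof -
  \<comment> \<open>Any listing of the nodes ordered by \<open>precedes\<close> serves;
    \<open>m_psi\<close> then turns its length into the claimed block size.\<close>
  obtain s where "set s = tree_nodes n" "sorted_wrt precedes s"
    using ex_sorted_tree_nodes by blast
  then interpret ordered_tree n k P s
    using assms by unfold_locales
  show ?thesis
    using rooted_directed_monomial_tree[OF assms(1)] card_tree_nodes
      pencil_carrier M_is_linearization M_uses_tree
    unfolding m_psi by auto
qed

end
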